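(* Let $k\ge1$ be an integer. For any $p\in[-\infty,\infty]$ and any vector $\mathbf u\in\mathbb R^k$ with $M_2(\mathbf u)=1$, $$\limsup_{\alpha\downarrow0,\ \beta\uparrow1}\mathrm{ARE}_{p,2,\mathbf u}(\alpha,\beta)\le1.$$
   Context: The dimension $k$, $p$ and $\mathbf u$ are fixed, and the upper limit is taken as $\alpha\downarrow0$ and $\beta\uparrow1$ jointly. $p$-means: for real $p\ne0$ and $\mathbf x\in\mathbb R^k$, $M_p(\mathbf x):=\big(\frac1k\sum_{j=1}^k|x_j|^p\big)^{1/p}$, where for $p<0$ the conventions $0^p:=\infty$ and $\infty^{1/p}:=0$ are used (so $M_p(\mathbf x)=0$ if $p<0$ and some $x_j=0$); also $M_{-\infty}(\mathbf x)=\min_j|x_j|$, $M_0(\mathbf x)=\prod_{j=1}^k|x_j|^{1/k}$, $M_\infty(\mathbf x)=\max_j|x_j|$. Let $\mathbf Z$ be a standard normal random vector in $\mathbb R^k$ (zero mean, identity covariance), and let $0<\alpha<\beta<1$. For $p\in[-\infty,\infty]$ let $c_p=c_{p,\alpha}$ be the unique positive root $c$ of $\mathsf P(M_p(\mathbf Z)>c)=\alpha$. For $\mathbf u\in\mathbb R^k$ with $M_2(\mathbf u)=1$, let $\mathbf s_p=\mathbf s_{p;\alpha,\beta,\mathbf u}$ be the vector $\mathbf s$ in the direction of $\mathbf u$ (i.e. $\mathbf s=t\mathbf u$ with $t>0$) such that $\mathsf P(M_p(\mathbf Z+\mathbf s)>c_p)=\beta$, provided such a vector exists; if it exists, it is unique.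 It exists for all $p\in[0,\infty]$ and all $\mathbf u$; in particular $\mathbf s_2$ always exists. Define (the asymptotic relative efficiency of the $p$-mean test relative to the $2$-mean test in direction $\mathbf u$) $$\mathrm{ARE}_{p,2,\mathbf u}(\alpha,\beta):=\frac{\|\mathbf s_2\|^2}{\|\mathbf s_p\|^2}$$ if $\mathbf s_p$ exists, and $\mathrm{ARE}_{p,2,\mathbf u}(\alpha,\beta):=0$ otherwise; $\|\cdot\|$ is the Euclidean norm. *)

theory Defs
  imports "HOL-Probability.Probability"
begin

text \<open>The dimension \<open>k\<close> is \<open>CARD('k)\<close>. The case \<open>p < 0\<close> with a zero coordinate is separated
  because \<open>0 powr p = 0\<close>, whereas the convention here is \<open>0\<^sup>p = \<infinity>\<close> and \<open>\<infinity>\<close> to the power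
  \<open>1/p\<close> is \<open>0\<close>.\<close>

definition pmean :: "ereal \<Rightarrow> real ^ 'k \<Rightarrow> real" where
  "pmean p x =
    (if p = -\<infinity> then Min (range (\<lambda>j. \<bar>x $ j\<bar>))
     else if p = \<infinity> then Max (range (\<lambda>j. \<bar>x $ j\<bar>))
     else if p = 0 then (\<Prod>j\<in>UNIV. \<bar>x $ j\<bar> powr (1 / real CARD('k)))
     else if p < 0 \<and> (\<exists>j. x $ j = 0) then 0
     else ((1 / real CARD('k)) * (\<Sum>j\<in>UNIV. \<bar>x $ j\<bar> powr real_of_ereal p))
            powr (1 / real_of_ereal p))"

definition std_normal_vec :: "(real ^ 'k) measure" where
  "std_normal_vec = density lborel (\<lambda>z. ennreal (\<Prod>j\<in>UNIV. std_normal_density (z $ j)))"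

text \<open>The law \<open>std_normal_vec\<close> depends on the dimension only through its type, so in
  \<open>crit_val\<close> the dimension is supplied by a type token.\<close>

definition crit_val :: "'k::finite itself \<Rightarrow> ereal \<Rightarrow> real \<Rightarrow> real" where
  "crit_val _ p \<alpha> =
    (THE c. c > 0 \<and> \<P>(z in (std_normal_vec :: (real ^ 'k) measure). pmean p z > c) = \<alpha>)"

definition is_shift ::
    "ereal \<Rightarrow> real \<Rightarrow> real \<Rightarrow> real ^ 'k \<Rightarrow> real ^ 'k \<Rightarrow> bool" where
  "is_shift p \<alpha> \<beta> u s \<longleftrightarrow>
    (\<exists>t>0. s = t *\<^sub>R u) \<and>
    \<P>(z in std_normal_vec. pmean p (z + s) > crit_val TYPE('k) p \<alpha>) = \<beta>"

definition shift :: "ereal \<Rightarrow> real \<Rightarrow> real \<Rightarrow> real ^ 'k \<Rightarrow> real ^ 'k" where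
  "shift p \<alpha> \<beta> u = (THE s. is_shift p \<alpha> \<beta> u s)"

text \<open>Asymptotic relative efficiency of the \<open>p\<close>-mean test relative to the \<open>2\<close>-mean test.\<close>

definition ARE2 :: "ereal \<Rightarrow> real ^ 'k \<Rightarrow> real \<Rightarrow> real \<Rightarrow> real" where
  "ARE2 p u \<alpha> \<beta> =
    (if \<exists>s. is_shift p \<alpha> \<beta> u s
     then (norm (shift 2 \<alpha> \<beta> u))\<^sup>2 / (norm (shift p \<alpha> \<beta> u))\<^sup>2
     else 0)"

end

theory Submission
  imports Defs "HOL-Real_Asymp.Real_Asymp"
begin

text \<open>Let \<open>e = u / \<parallel>u\<parallel>\<close> and let \<open>a\<close>, \<open>b\<close> be the normal quantiles given by
  \<open>P(Z \<bullet> e > a) = \<alpha>\<close> and \<open>P(Z \<bullet> e > b) = 1 - \<beta>\<close>. By the Neyman--Pearson lemma every test of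
  size \<open>\<alpha>\<close> that has power \<open>\<beta>\<close> at \<open>s\<close> satisfies \<open>\<parallel>s\<parallel> \<ge> a + b\<close>, whatever \<open>p\<close> is. The rejection
  region of the 2-mean test is the complement of a ball of some radius \<open>r\<close>; it contains the
  half-space \<open>{x. x \<bullet> e > r}\<close>, so \<open>\<parallel>s\<^sub>2\<parallel> \<le> r + b\<close>. Gaussian tail bounds give \<open>r \<le> (1 + \<epsilon>) a\<close>
  for small \<open>\<alpha>\<close>, and hence \<open>ARE \<le> (1 + \<epsilon>)\<^sup>2\<close>.

  Since critical values and shifts are definite descriptions, their uniqueness is also needed.
  For the shifts, reflections in the coordinates show that the power is monotone in each
  \<open>\<bar>s\<^sub>j\<bar>\<close>; if it took the same value at two points of the ray, it would be periodic, hence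
  constant, in each coordinate with \<open>u\<^sub>j \<noteq> 0\<close>, and so equal to its value \<open>\<alpha>\<close> at \<open>0\<close>.\<close>

subsection \<open>Power means\<close>

lemma measurable_vec_nth_borel [measurable]: "(\<lambda>x :: real ^ 'k. x $ j) \<in> borel_measurable borel"
  by (intro borel_measurable_continuous_onI continuous_intros)

lemma pmean_ereal:
  fixes x :: "real ^ 'k"
  assumes "r \<noteq> 0"
  shows "pmean (ereal r) x =
    (if r < 0 \<and> (\<exists>j. x $ j = 0) then 0
     else ((1 / real CARD('k)) * (\<Sum>j\<in>UNIV. \<bar>x $ j\<bar> powr r)) powr (1 / r))"
  using assms by (simp add: pmean_def zero_ereal_def) auto

lemma exponent_cases [case_names minf pinf zero pos neg]:
  fixes p :: ereal
  obtains "p = -\<infinity>" | "p = \<infinity>" | "p = 0" | r where "p = ereal r" "r > 0"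
    | r where "p = ereal r" "r < 0"
proof (cases p)
  case (real r)
  then show ?thesis using that by (cases r "0::real" rule: linorder_cases) (auto simp: zero_ereal_def)
qed (use that in auto)

lemma borel_measurable_pmean [measurable]: "pmean p \<in> borel_measurable (borel :: (real ^ 'k) measure)"
proof (cases p rule: exponent_cases)
  case minf
  have "(\<lambda>x :: real ^ 'k. Min ((\<lambda>j. \<bar>x $ j\<bar>) ` UNIV)) \<in> borel_measurable borel"
    by measurable
  then show ?thesis using minf by (simp add: pmean_def[abs_def])
next
  case pinf
  have "(\<lambda>x :: real ^ 'k. Max ((\<lambda>j. \<bar>x $ j\<bar>) ` UNIV)) \<in> borel_measurable borel"
    by measurable
  then show ?thesis using pinf by (simp add: pmean_def[abs_def])
next
  case zero
  then show ?thesis by (simp add: pmean_def[abs_def])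
next
  case (pos r)
  then have "pmean p = (\<lambda>x :: real ^ 'k.
      ((1 / real CARD('k)) * (\<Sum>j\<in>UNIV. \<bar>x $ j\<bar> powr r)) powr (1 / r))"
    by (simp add: pmean_ereal fun_eq_iff)
  then show ?thesis by simp
next
  case (neg r)
  have "pmean p = (\<lambda>x :: real ^ 'k. if \<exists>j. x $ j = 0 then 0
     else ((1 / real CARD('k)) * (\<Sum>j\<in>UNIV. \<bar>x $ j\<bar> powr r)) powr (1 / r))"
    using neg by (simp add: pmean_ereal fun_eq_iff)
  then show ?thesis by simp
qed

lemma pmean_nonneg: "0 \<le> pmean p (x :: real ^ 'k)"
proof (cases p rule: exponent_cases)
  case pinf
  \<comment> \<open>Any coordinate would do here; \<open>undefined\<close> names one.\<close>
  have "\<bar>x $ undefined\<bar> \<le> Max (range (\<lambda>j. \<bar>x $ j\<bar>))"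
    by (intro Max_ge) auto
  then have "0 \<le> Max (range (\<lambda>j. \<bar>x $ j\<bar>))"
    using abs_ge_zero[of "x $ undefined"] by (rule order_trans[rotated])
  then show ?thesis using pinf by (simp add: pmean_def)
qed (auto simp: pmean_def zero_ereal_def intro!: prod_nonneg)

lemma pmean_pos:
  assumes "\<And>j. x $ j \<noteq> 0"
  shows "0 < pmean p (x :: real ^ 'k)"
proof (cases p rule: exponent_cases)
  case pinf
  have "\<bar>x $ undefined\<bar> \<le> Max (range (\<lambda>j. \<bar>x $ j\<bar>))"
    by (intro Max_ge) auto
  then have "0 < Max (range (\<lambda>j. \<bar>x $ j\<bar>))"
    using assms[of undefined] by (meson less_le_trans zero_less_abs_iff)
  then show ?thesis using pinf by (simp add: pmean_def)
next
  case (pos r)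
  have "0 < (\<Sum>j\<in>(UNIV::'k set). \<bar>x $ j\<bar> powr r)"
    using assms by (intro sum_pos) auto
  then show ?thesis using pos by (simp add: pmean_ereal)
next
  case (neg r)
  have "0 < (\<Sum>j\<in>(UNIV::'k set). \<bar>x $ j\<bar> powr r)"
    using assms by (intro sum_pos) auto
  then show ?thesis using neg assms by (simp add: pmean_ereal)
qed (use assms in \<open>auto simp: pmean_def intro!: prod_pos\<close>)

lemma pmean_scaleR:
  fixes x :: "real ^ 'k"
  assumes "0 < c"
  shows "pmean p (c *\<^sub>R x) = c * pmean p x"
proof -
  have mono: "mono ((*) c)" using assms by (auto intro!: monoI)
  have im: "range (\<lambda>j. c * \<bar>x $ j\<bar>) = (*) c ` range (\<lambda>j. \<bar>x $ j\<bar>)"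
    by auto
  have step: "((1 / real CARD('k)) * (\<Sum>j\<in>UNIV. \<bar>(c *\<^sub>R x) $ j\<bar> powr r)) powr (1 / r)
      = c * ((1 / real CARD('k)) * (\<Sum>j\<in>UNIV. \<bar>x $ j\<bar> powr r)) powr (1 / r)"
    if "r \<noteq> 0" for r
  proof -
    have "(1 / real CARD('k)) * (\<Sum>j\<in>UNIV. \<bar>(c *\<^sub>R x) $ j\<bar> powr r)
        = c powr r * ((1 / real CARD('k)) * (\<Sum>j\<in>UNIV. \<bar>x $ j\<bar> powr r))"
      using assms by (simp add: abs_mult powr_mult sum_distrib_left mult_ac)
    also have "\<dots> powr (1 / r)
        = (c powr r) powr (1 / r) * ((1 / real CARD('k)) * (\<Sum>j\<in>UNIV. \<bar>x $ j\<bar> powr r)) powr (1 / r)"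
      by (intro powr_mult)
    finally show ?thesis using assms that by (simp add: powr_powr)
  qed
  show ?thesis
  proof (cases p rule: exponent_cases)
    case minf
    then show ?thesis using assms
      by (simp add: pmean_def abs_mult im mono_Min_commute[OF mono])
  next
    case pinf
    then show ?thesis using assms
      by (simp add: pmean_def abs_mult im mono_Max_commute[OF mono])
  next
    case zero
    have "(\<Prod>j\<in>(UNIV::'k set). c powr (1 / real CARD('k))) = c"
      using assms by (simp add: powr_realpow[symmetric] powr_powr)
    then show ?thesis using zero assms
      by (simp add: pmean_def abs_mult powr_mult prod.distrib)
  next
    case (pos r)
    then show ?thesis using step[of r] by (simp add: pmean_ereal)
  next
    case (neg r)
    then show ?thesis using step[of r] assms by (simp add: pmean_ereal)
  qed
qed

lemma pmean_mono:
  fixes x y :: "real ^ 'k"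
  assumes le: "\<And>j. \<bar>x $ j\<bar> \<le> \<bar>y $ j\<bar>"
  shows "pmean p x \<le> pmean p y"
proof (cases p rule: exponent_cases)
  case minf
  have "Min (range (\<lambda>j. \<bar>x $ j\<bar>)) \<le> \<bar>y $ j\<bar>" for j
    by (rule order_trans[OF Min_le le[of j]]) auto
  then show ?thesis using minf by (simp add: pmean_def)
next
  case pinf
  have "\<bar>x $ j\<bar> \<le> Max (range (\<lambda>j. \<bar>y $ j\<bar>))" for j
    by (rule order_trans[OF le[of j] Max_ge]) auto
  then show ?thesis using pinf by (simp add: pmean_def)
next
  case zero
  then show ?thesis using le
    by (auto simp: pmean_def intro!: prod_mono powr_mono2)
next
  case (pos r)
  have "(\<Sum>j\<in>UNIV. \<bar>x $ j\<bar> powr r) \<le> (\<Sum>j\<in>UNIV. \<bar>y $ j\<bar> powr r)"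
    using pos le by (intro sum_mono powr_mono2) auto
  then show ?thesis using pos
    by (auto simp: pmean_ereal divide_right_mono sum_nonneg intro!: powr_mono2)
next
  case (neg r)
  show ?thesis
  proof (cases "\<exists>j. x $ j = 0")
    case True
    then have "pmean p x = 0" using neg by (simp add: pmean_ereal)
    then show ?thesis using pmean_nonneg[of p y] by simp
  next
    case False
    with le have nz: "y $ j \<noteq> 0" for j
      by (metis abs_eq_0 abs_le_zero_iff)
    \<comment> \<open>For negative \<open>r\<close> both \<open>powr r\<close> and
      \<open>powr (1 / r)\<close> are decreasing on positive arguments, so the two reversals of the
      order cancel.\<close>
    have "(\<Sum>j\<in>UNIV. \<bar>y $ j\<bar> powr r) \<le> (\<Sum>j\<in>UNIV. \<bar>x $ j\<bar> powr r)"
      using neg le False by (intro sum_mono powr_mono2') auto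
    moreover have "0 < (\<Sum>j\<in>(UNIV::'k set). \<bar>y $ j\<bar> powr r)"
      using nz by (intro sum_pos) auto
    ultimately show ?thesis using neg False nz
      by (auto simp: pmean_ereal divide_right_mono intro!: powr_mono2')
  qed
qed

lemma pmean_2: "pmean 2 (x :: real ^ 'k) = norm x / sqrt (real CARD('k))"
proof -
  have "(2 :: ereal) = ereal 2" by simp
  then have "pmean 2 x = ((1 / real CARD('k)) * (\<Sum>j\<in>UNIV. (x $ j)\<^sup>2)) powr (1 / 2)"
    by (simp only: pmean_ereal) (simp add: powr_numeral)
  also have "\<dots> = sqrt ((1 / real CARD('k)) * (\<Sum>j\<in>UNIV. (x $ j)\<^sup>2))"
    by (intro powr_half_sqrt) (auto intro!: sum_nonneg divide_nonneg_nonneg)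
  finally show ?thesis
    by (simp add: norm_vec_def L2_set_def real_sqrt_divide)
qed

subsection \<open>The Gaussian density\<close>

definition gauss :: "real ^ 'k \<Rightarrow> real" where
  "gauss z = (\<Prod>j\<in>UNIV. std_normal_density (z $ j))"

text \<open>Stated for general \<open>\<sigma>\<close>: the value 1 gives the density of the test
  statistic's noise, and a wider Gaussian later serves as comparison density in the tail bound for
  the norm.\<close>

lemma prod_normal_density_vec:
  fixes z :: "real ^ 'k"
  shows "(\<Prod>j\<in>UNIV. normal_density 0 \<sigma> (z $ j))
    = (1 / sqrt (2 * pi * \<sigma>\<^sup>2)) ^ CARD('k) * exp (- (norm z)\<^sup>2 / (2 * \<sigma>\<^sup>2))"
proof -
  have "(norm z)\<^sup>2 = (\<Sum>j\<in>UNIV. (z $ j)\<^sup>2)"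
    by (simp add: norm_vec_def L2_set_def sum_nonneg)
  then have "exp (- (norm z)\<^sup>2 / (2 * \<sigma>\<^sup>2)) = (\<Prod>j\<in>UNIV. exp (- (z $ j)\<^sup>2 / (2 * \<sigma>\<^sup>2)))"
    by (simp add: exp_sum[symmetric] sum_divide_distrib sum_negf)
  then show ?thesis
    by (simp only: normal_density_def prod.distrib prod_constant) simp
qed

lemma nn_integral_prod_normal_density_vec:
  assumes "0 < \<sigma>"
  shows "(\<integral>\<^sup>+z. ennreal (\<Prod>j\<in>UNIV. normal_density 0 \<sigma> ((z :: real ^ 'k) $ j)) \<partial>lborel) = 1"
proof -
  have inj: "inj (\<lambda>j :: 'k. axis j (1 :: real))"
    by (auto simp: inj_on_def axis_eq_axis)
  have B: "(Basis :: (real ^ 'k) set) = range (\<lambda>j. axis j 1)"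
    by (auto simp: Basis_vec_def)
  have one: "(\<integral>\<^sup>+x. ennreal (normal_density 0 \<sigma> x) \<partial>lborel) = 1"
    using assms by (subst nn_integral_eq_integral) (auto intro: integrable_normal_density)
  have "(\<integral>\<^sup>+z. ennreal (\<Prod>j\<in>UNIV. normal_density 0 \<sigma> ((z :: real ^ 'k) $ j)) \<partial>lborel)
     = (\<integral>\<^sup>+z. (\<Prod>b\<in>Basis. ennreal (normal_density 0 \<sigma> ((z :: real ^ 'k) \<bullet> b))) \<partial>lborel)"
    using inj by (simp add: B prod.reindex prod_ennreal inner_axis)
  also have "\<dots> = (\<Prod>b\<in>(Basis :: (real ^ 'k) set). \<integral>\<^sup>+x. ennreal (normal_density 0 \<sigma> x) \<partial>lborel)"
    by (rule nn_integral_lborel_prod) auto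
  finally show ?thesis by (simp add: one)
qed

lemma gauss_eq:
  "gauss (z :: real ^ 'k) = (1 / sqrt (2 * pi)) ^ CARD('k) * exp (- (norm z)\<^sup>2 / 2)"
  using prod_normal_density_vec[of 1 z] by (simp add: gauss_def)

lemma gauss_pos: "0 < gauss z"
  by (simp add: gauss_eq)

lemma borel_measurable_gauss [measurable]: "gauss \<in> borel_measurable borel"
  unfolding gauss_def[abs_def] by measurable

lemma gauss_uminus: "gauss (- z) = gauss z"
  by (simp add: gauss_eq)

lemma std_normal_vec_eq: "std_normal_vec = density lborel (\<lambda>z. ennreal (gauss z))"
  by (simp add: std_normal_vec_def gauss_def)

lemma sets_std_normal_vec [measurable_cong, simp]: "sets std_normal_vec = sets borel"
  by (simp add: std_normal_vec_eq)

lemma space_std_normal_vec [simp]: "space std_normal_vec = UNIV"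
  by (simp add: std_normal_vec_eq)

lemma prob_space_std_normal_vec: "prob_space (std_normal_vec :: (real ^ 'k) measure)"
proof
  show "emeasure (std_normal_vec :: (real ^ 'k) measure) (space std_normal_vec) = 1"
    using nn_integral_prod_normal_density_vec[where 'k = 'k, of 1]
    by (simp add: std_normal_vec_def emeasure_density)
qed

interpretation std_normal_vec: prob_space std_normal_vec
  by (rule prob_space_std_normal_vec)

text \<open>The density is strictly positive, so both measures have the same null sets. Null sets
  can thus be found by geometry or scaling under \<open>lborel\<close> and then transferred.\<close>

lemma AE_std_normal_vec_iff: "(AE x in std_normal_vec. P x) \<longleftrightarrow> (AE x in lborel. P x)"
  unfolding std_normal_vec_eq by (subst AE_density) (auto simp: gauss_pos)

lemma integrable_gauss_shift: "integrable lborel (\<lambda>x. gauss (x - s))"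
proof -
  have "integrable lborel gauss"
  proof (rule integrableI_nonneg)
    show "(\<integral>\<^sup>+z. ennreal (gauss (z :: real ^ 'k)) \<partial>lborel) < \<infinity>"
      using nn_integral_prod_normal_density_vec[where 'k = 'k, of 1]
      by (simp add: gauss_def)
  qed (auto simp: less_imp_le[OF gauss_pos])
  then have "integrable (distr lborel borel ((+) (- s))) gauss"
    by (simp add: lborel_distr_plus)
  then show ?thesis
    by (subst (asm) integrable_distr_eq) auto
qed

subsection \<open>Rejection probabilities under a shift\<close>

text \<open>This is the power function of the test with rejection region \<open>A\<close>, evaluated
  at the mean \<open>s\<close>.\<close>

definition rejection_prob :: "(real ^ 'k) set \<Rightarrow> real ^ 'k \<Rightarrow> real" where
  "rejection_prob A s = measure std_normal_vec {z. z + s \<in> A}"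

lemma measure_std_normal_vec:
  assumes [measurable]: "A \<in> sets borel"
  shows "measure std_normal_vec A = (\<integral>x. indicator A x * gauss x \<partial>lborel)"
proof -
  have "measure std_normal_vec A = (\<integral>x. indicator A x \<partial>std_normal_vec)"
    by simp
  also have "\<dots> = (\<integral>x. gauss x *\<^sub>R indicator A x \<partial>lborel)"
    unfolding std_normal_vec_eq
    by (rule integral_density) (auto simp: less_imp_le[OF gauss_pos])
  finally show ?thesis by (simp add: mult.commute)
qed

text \<open>Translation invariance moves the shift from the region to the density, so that powers at
  different means become integrals over the same region.\<close>

lemma rejection_prob_eq:
  assumes [measurable]: "A \<in> sets borel"
  shows "rejection_prob A s = (\<integral>x. indicator A x * gauss (x - s) \<partial>lborel)"
proof -
  have "rejection_prob A s = (\<integral>x. indicator {z. z + s \<in> A} x * gauss x \<partial>lborel)"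
    unfolding rejection_prob_def by (rule measure_std_normal_vec) measurable
  also have "\<dots> = (\<integral>x. indicator {z. z + s \<in> A} x * gauss x \<partial>distr lborel borel ((+) (- s)))"
    by (simp add: lborel_distr_plus)
  also have "\<dots> = (\<integral>x. indicator A x * gauss (x - s) \<partial>lborel)"
    by (subst integral_distr) (auto simp: indicator_def intro!: Bochner_Integration.integral_cong)
  finally show ?thesis .
qed

lemma integrable_pw:
  assumes [measurable]: "A \<in> sets borel"
  shows "integrable lborel (\<lambda>x. indicator A x * gauss (x - s))"
  using integrable_mult_indicator[OF _ integrable_gauss_shift, of A s] by simp

lemma rejection_prob_0: "rejection_prob A 0 = measure std_normal_vec A"
  by (simp add: rejection_prob_def)

lemma rejection_prob_mono: "A \<subseteq> B \<Longrightarrow> B \<in> sets borel \<Longrightarrow> rejection_prob A s \<le> rejection_prob B s"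
  unfolding rejection_prob_def by (rule std_normal_vec.finite_measure_mono) (auto, measurable)

lemma measure_std_normal_vec_open_pos:
  assumes "open U" "U \<noteq> {}"
  shows "0 < measure std_normal_vec U"
proof (rule ccontr)
  assume "\<not> ?thesis"
  then have "measure std_normal_vec U = 0" by (simp add: zero_less_measure_iff)
  then have "AE x in std_normal_vec. x \<notin> U"
    using assms by (subst std_normal_vec.prob_eq_0[symmetric]) (auto simp: borel_open)
  then have "AE x in lebesgue. x \<notin> U"
    by (simp add: AE_std_normal_vec_iff AE_completion)
  then have "negligible U"
    using assms by (simp add: negligible_iff_null_sets AE_iff_null_sets borel_open sets_completionI_sets)
  then show False using open_not_negligible assms by blast
qed

subsection \<open>Reflections in a coordinate\<close>

definition upd :: "real ^ 'k \<Rightarrow> 'k \<Rightarrow> real \<Rightarrow> real ^ 'k" where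
  "upd x j y = (\<chi> i. if i = j then y else x $ i)"

lemma upd_nth [simp]: "upd x j y $ i = (if i = j then y else x $ i)"
  by (simp add: upd_def)

lemma upd_upd [simp]: "upd (upd x j y) j z = upd x j z"
  by (simp add: vec_eq_iff)

lemma upd_same [simp]: "upd x j (x $ j) = x"
  by (simp add: vec_eq_iff)

text \<open>The mirror is the hyperplane on which coordinate \<open>j\<close> equals
  \<open>m\<close>.\<close>

definition reflect :: "'k \<Rightarrow> real \<Rightarrow> real ^ 'k \<Rightarrow> real ^ 'k" where
  "reflect j m x = upd x j (2 * m - x $ j)"

lemma reflect_reflect [simp]: "reflect j m (reflect j m x) = x"
  by (simp add: reflect_def)

lemma norm_reflect_diff: "norm (reflect j m x - reflect j m y) = norm (x - y)"
  by (auto simp: reflect_def norm_vec_def L2_set_def power2_commute intro!: arg_cong[where f = sqrt] sum.cong)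

lemma gauss_reflect_diff: "gauss (reflect j m x - reflect j m y) = gauss (x - y)"
  by (simp add: gauss_eq norm_reflect_diff)

lemma borel_measurable_reflect [measurable]: "reflect j m \<in> borel_measurable borel"
proof (intro borel_measurable_continuous_onI)
  have "continuous_on UNIV (\<lambda>x. (\<chi> i. if i = j then 2 * m - x $ j else x $ i))"
    by (intro continuous_on_vec_lambda) (case_tac "i = j"; auto intro!: continuous_intros)
  then show "continuous_on UNIV (reflect j m)"
    by (simp add: reflect_def[abs_def] upd_def)
qed

lemma lborel_distr_reflect: "distr lborel borel (reflect j m) = (lborel :: (real ^ 'k) measure)"
proof -
  define c :: "real ^ 'k \<Rightarrow> real" where "c b = (if b = axis j 1 then - 1 else 1)" for b
  have inj: "inj (\<lambda>j :: 'k. axis j (1 :: real))"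
    by (auto simp: inj_on_def axis_eq_axis)
  have B: "(Basis :: (real ^ 'k) set) = range (\<lambda>j. axis j 1)"
    by (auto simp: Basis_vec_def)
  have comp: "(\<Sum>b\<in>Basis. (c b * (x \<bullet> b)) *\<^sub>R b) $ i = c (axis i 1) * x $ i" for x i
  proof -
    have "(\<Sum>b\<in>Basis. (c b * (x \<bullet> b)) *\<^sub>R b) $ i
        = (\<Sum>k\<in>UNIV. c (axis k 1) * x $ k * (axis k 1 :: real ^ 'k) $ i)"
      unfolding B sum.reindex[OF inj] by (simp add: inner_axis)
    also have "\<dots> = (\<Sum>k\<in>UNIV. if k = i then c (axis i 1) * x $ i else 0)"
      by (intro sum.cong) (auto simp: axis_def)
    finally show ?thesis by simp
  qed
  \<comment> \<open>A reflection is a translation after a diagonal map with entries 1 and -1, which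
    is the form that the affine transformation rule expects; its Jacobian factor is 1.\<close>
  have T: "reflect j m = (\<lambda>x. axis j (2 * m) + (\<Sum>b\<in>Basis. (c b * (x \<bullet> b)) *\<^sub>R b))"
    unfolding fun_eq_iff vec_eq_iff vector_add_component comp
    by (auto simp: reflect_def c_def axis_eq_axis) (auto simp: axis_def)
  have "(lborel :: (real ^ 'k) measure)
      = density (distr lborel borel (reflect j m)) (\<lambda>_. (\<Prod>b\<in>Basis. \<bar>c b\<bar>))"
    unfolding T by (rule lborel_affine_euclidean) (auto simp: c_def)
  also have "(\<Prod>b\<in>Basis. \<bar>c b\<bar>) = 1"
    by (intro prod.neutral) (auto simp: c_def)
  finally show ?thesis by (simp add: density_1)
qed

lemma integral_lborel_reflect:
  fixes f :: "real ^ 'k \<Rightarrow> real"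
  assumes [measurable]: "f \<in> borel_measurable borel"
  shows "(\<integral>x. f (reflect j m x) \<partial>lborel) = (\<integral>x. f x \<partial>lborel)"
  using integral_distr[of "reflect j m" lborel borel f] by (simp add: lborel_distr_reflect)

lemma integrable_lborel_reflect:
  fixes f :: "real ^ 'k \<Rightarrow> real"
  assumes "integrable lborel f"
  shows "integrable lborel (\<lambda>x. f (reflect j m x))"
proof -
  from assms have "integrable (distr lborel borel (reflect j m)) f"
    by (simp add: lborel_distr_reflect)
  with assms show ?thesis by (subst (asm) integrable_distr_eq) auto
qed

lemma AE_lborel_neq_coordinate: "AE x in lborel. (x :: real ^ 'k) $ j \<noteq> m"
proof -
  have "negligible {x :: real ^ 'k. axis j 1 \<bullet> x = m}"
    by (intro negligible_hyperplane) (simp add: axis_eq_0_iff)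
  moreover have [measurable]: "{x :: real ^ 'k. x $ j = m} \<in> sets borel" by measurable
  ultimately have "{x :: real ^ 'k. x $ j = m} \<in> null_sets lborel"
    by (simp add: negligible_iff_null_sets inner_axis' null_sets_completion_iff)
  then show ?thesis by (rule AE_I') auto
qed

subsection \<open>Regions that are increasing in the absolute values of the coordinates\<close>

text \<open>The monotonicity of the p-means gives every rejection region this property. It includes
  invariance under sign changes of coordinates, since these preserve all absolute values.\<close>

definition abs_upper :: "(real ^ 'k) set \<Rightarrow> bool" where
  "abs_upper A \<longleftrightarrow> (\<forall>x\<in>A. \<forall>y. (\<forall>j. \<bar>x $ j\<bar> \<le> \<bar>y $ j\<bar>) \<longrightarrow> y \<in> A)"

lemma abs_upperD: "abs_upper A \<Longrightarrow> x \<in> A \<Longrightarrow> (\<And>j. \<bar>x $ j\<bar> \<le> \<bar>y $ j\<bar>) \<Longrightarrow> y \<in> A"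
  by (auto simp: abs_upper_def)

text \<open>Changing variables by the reflection moves the mirror image of \<open>s\<close> back to
  \<open>s\<close>, and alters the region only by a null set.\<close>

lemma rejection_prob_reflect_invariant:
  assumes [measurable]: "A \<in> sets borel"
    and inv: "AE x in lborel. reflect j m x \<in> A \<longleftrightarrow> x \<in> A"
  shows "rejection_prob A (reflect j m s) = rejection_prob A s"
proof -
  have "rejection_prob A (reflect j m s) =
      (\<integral>x. indicator A (reflect j m x) * gauss (reflect j m x - reflect j m s) \<partial>lborel)"
    by (subst integral_lborel_reflect) (auto simp: rejection_prob_eq)
  also have "\<dots> = (\<integral>x. indicator A x * gauss (x - s) \<partial>lborel)"
    unfolding gauss_reflect_diff
  proof (rule integral_cong_AE)
    show "AE x in lborel. indicator A (reflect j m x) * gauss (x - s) = indicator A x * gauss (x - s)"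
      using inv by eventually_elim (simp add: indicator_def)
  qed measurable
  finally show ?thesis by (simp add: rejection_prob_eq)
qed

text \<open>The reflection turns the difference of the two powers into the integral of a product of
  two factors that are both nonnegative on one side of the mirror and both nonpositive on the
  other.\<close>

lemma rejection_prob_reflect:
  assumes A [measurable]: "A \<in> sets borel" and up: "abs_upper A"
    and m: "0 \<le> m" and s: "s $ j \<le> m"
  shows rejection_prob_reflect_mono: "rejection_prob A s \<le> rejection_prob A (reflect j m s)"
    and rejection_prob_reflect_eqD: "s $ j < m \<Longrightarrow> rejection_prob A (reflect j m s) = rejection_prob A s \<Longrightarrow>
      rejection_prob A (reflect j m x) = rejection_prob A x"
proof -
  let ?R = "reflect j m"
  define d where "d x = gauss (x - ?R s) - gauss (x - s)" for x
  define g where "g x = (indicator A x - indicator A (?R x)) * d x" for x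
  have [measurable]: "d \<in> borel_measurable borel" unfolding d_def[abs_def] by measurable
  \<comment> \<open>The reflection exchanges the two densities, so \<open>d\<close> is odd under
    it.\<close>
  have dR: "d (?R x) = - d x" for x
    using gauss_reflect_diff[of j m "?R x" s] gauss_reflect_diff[of j m x s] by (simp add: d_def)
  have int: "integrable lborel (\<lambda>x. indicator A x * d x)"
    unfolding d_def using integrable_pw[OF A, of "?R s"] integrable_pw[OF A, of s]
    by (simp add: right_diff_distrib)
  have intR: "integrable lborel (\<lambda>x. indicator A (?R x) * d x)"
    using integrable_lborel_reflect[OF int, of j m] by (simp add: dR)
  have int_g: "integrable lborel g"
    unfolding g_def[abs_def] left_diff_distrib using int intR by (rule Bochner_Integration.integrable_diff)
  have D: "rejection_prob A (?R s) - rejection_prob A s = (\<integral>x. indicator A x * d x \<partial>lborel)"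
    unfolding rejection_prob_eq[OF A] d_def right_diff_distrib
    by (rule Bochner_Integration.integral_diff[symmetric]) (intro integrable_pw A)+
  have "(\<integral>x. indicator A (?R x) * d x \<partial>lborel) = - (\<integral>x. indicator A x * d x \<partial>lborel)"
    using integral_lborel_reflect[of "\<lambda>x. indicator A x * d x" j m] by (simp add: dR)
  \<comment> \<open>The factor 2 appears because, \<open>d\<close> being odd, \<open>A\<close> and
    its mirror image contribute opposite integrals of \<open>d\<close>, which \<open>g\<close>
    subtracts.\<close>
  then have G: "(\<integral>x. g x \<partial>lborel) = 2 * (rejection_prob A (?R s) - rejection_prob A s)"
    unfolding g_def left_diff_distrib using int intR by (simp add: D)
  have diff: "(norm (x - s))\<^sup>2 - (norm (x - ?R s))\<^sup>2 = 4 * (m - s $ j) * (x $ j - m)" for x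
  proof -
    have "(norm (x - s))\<^sup>2 - (norm (x - ?R s))\<^sup>2
        = (\<Sum>i\<in>UNIV. (x $ i - s $ i)\<^sup>2 - (x $ i - ?R s $ i)\<^sup>2)"
      by (simp add: norm_vec_def L2_set_def sum_nonneg sum_subtractf)
    also have "\<dots> = (\<Sum>i\<in>UNIV. if i = j then 4 * (m - s $ j) * (x $ j - m) else 0)"
      by (intro sum.cong) (auto simp: reflect_def power2_eq_square algebra_simps)
    finally show ?thesis by simp
  qed
  have d_sign: "0 \<le> d x \<longleftrightarrow> (norm (x - ?R s))\<^sup>2 \<le> (norm (x - s))\<^sup>2"
    "d x \<le> 0 \<longleftrightarrow> (norm (x - s))\<^sup>2 \<le> (norm (x - ?R s))\<^sup>2" for x
    by (simp_all add: d_def gauss_eq)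
  \<comment> \<open>For \<open>x $ j \<ge> m \<ge> 0\<close> the reflected coordinate
    \<open>2 * m - x $ j\<close> lies between \<open>- x $ j\<close> and
    \<open>x $ j\<close>.\<close>
  have side: "?R x \<in> A \<Longrightarrow> m \<le> x $ j \<Longrightarrow> x \<in> A" for x
    using m by (elim abs_upperD[OF up]) (auto simp: reflect_def)
  have g_nonneg: "0 \<le> g x" for x
  proof (cases "m \<le> x $ j")
    case True
    then have "0 \<le> d x" using diff[of x] s d_sign(1)[of x]
      by (smt (verit) mult_nonneg_nonneg)
    moreover have "indicator A (?R x) \<le> (indicator A x :: real)"
      using side[of x] True by (auto simp: indicator_def)
    ultimately show ?thesis by (simp add: g_def)
  next
    case False
    then have "d x \<le> 0" using diff[of x] s d_sign(2)[of x]
      by (smt (verit) mult_nonneg_nonpos)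
    moreover have "indicator A x \<le> (indicator A (?R x) :: real)"
      using side[of "?R x"] False by (auto simp: indicator_def) (auto simp: reflect_def)
    ultimately show ?thesis by (simp add: g_def mult_nonpos_nonpos)
  qed
  show "rejection_prob A s \<le> rejection_prob A (?R s)"
    using G Bochner_Integration.integral_nonneg[of lborel g] g_nonneg by simp
  assume lt: "s $ j < m" and eq: "rejection_prob A (?R s) = rejection_prob A s"
  \<comment> \<open>Equal powers force the nonnegative \<open>g\<close> to vanish almost everywhere.
    Off the mirror \<open>d\<close> is nonzero, so \<open>A\<close> is symmetric up to a null set,
    and then the powers agree at every mean.\<close>
  have "AE x in lborel. g x = 0"
    using G eq int_g g_nonneg integral_nonneg_eq_0_iff_AE[of lborel g] by simp
  then have "AE x in lborel. ?R x \<in> A \<longleftrightarrow> x \<in> A"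
    using AE_lborel_neq_coordinate[of j m]
  proof eventually_elim
    case (elim x)
    then have "d x \<noteq> 0" using diff[of x] lt d_sign[of x] by auto
    then show ?case using elim by (auto simp: g_def indicator_def split: if_splits)
  qed
  then show "rejection_prob A (?R x) = rejection_prob A x" by (rule rejection_prob_reflect_invariant[OF A])
qed

lemma rejection_prob_upd_uminus:
  assumes A: "A \<in> sets borel" and up: "abs_upper A"
  shows "rejection_prob A (upd s j (- y)) = rejection_prob A (upd s j y)"
proof -
  have "rejection_prob A (reflect j 0 (upd s j y)) = rejection_prob A (upd s j y)"
    using A by (intro rejection_prob_reflect_invariant AE_I2) (auto elim!: abs_upperD[OF up] simp: reflect_def)
  then show ?thesis by (simp add: reflect_def)
qed

lemma rejection_prob_upd_mono:
  assumes A: "A \<in> sets borel" and up: "abs_upper A" and le: "\<bar>y\<bar> \<le> \<bar>z\<bar>"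
  shows "rejection_prob A (upd s j y) \<le> rejection_prob A (upd s j z)"
proof -
  have abs: "rejection_prob A (upd s j \<bar>v\<bar>) = rejection_prob A (upd s j v)" for v
    using rejection_prob_upd_uminus[OF A up] by (simp add: abs_if)
  \<comment> \<open>The mirror at the midpoint carries \<open>\<bar>y\<bar>\<close> to
    \<open>\<bar>z\<bar>\<close>.\<close>
  have "rejection_prob A (upd s j \<bar>y\<bar>) \<le> rejection_prob A (reflect j ((\<bar>y\<bar> + \<bar>z\<bar>) / 2) (upd s j \<bar>y\<bar>))"
    using le by (intro rejection_prob_reflect_mono[OF A up]) auto
  also have "\<dots> = rejection_prob A (upd s j \<bar>z\<bar>)" by (simp add: reflect_def add_divide_distrib)
  finally show ?thesis by (simp only: abs)
qed

lemma rejection_prob_abs_mono: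
  assumes A: "A \<in> sets borel" and up: "abs_upper A" and le: "\<And>j. \<bar>s $ j\<bar> \<le> \<bar>s' $ j\<bar>"
  shows "rejection_prob A s \<le> rejection_prob A s'"
proof -
  \<comment> \<open>Coordinates are exchanged one at a time; \<open>J\<close> collects those already
    exchanged.\<close>
  have "rejection_prob A s \<le> rejection_prob A (\<chi> i. if i \<in> J then s' $ i else s $ i)" if "finite J" for J
    using that
  proof induction
    case (insert j J)
    let ?v = "\<chi> i. if i \<in> J then s' $ i else s $ i"
    have "rejection_prob A (upd ?v j (s $ j)) \<le> rejection_prob A (upd ?v j (s' $ j))"
      by (rule rejection_prob_upd_mono[OF A up le])
    moreover have "upd ?v j (s $ j) = ?v" using insert by (auto simp: vec_eq_iff)
    moreover have "upd ?v j (s' $ j) = (\<chi> i. if i \<in> insert j J then s' $ i else s $ i)"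
      by (auto simp: vec_eq_iff)
    ultimately show ?case using insert.IH by simp
  qed simp
  from this[of UNIV] show ?thesis by simp
qed

text \<open>Invariance under the mirrors at \<open>0\<close> and at \<open>m\<close> gives the period \<open>2 m\<close>, and a
  periodic function that is monotone in the absolute value is constant.\<close>

lemma rejection_prob_upd_const:
  assumes A: "A \<in> sets borel" and up: "abs_upper A" and m: "0 < m"
    and inv: "\<And>x. rejection_prob A (reflect j m x) = rejection_prob A x"
  shows "rejection_prob A (upd s j 0) = rejection_prob A s"
proof -
  have per: "rejection_prob A (upd s j (2 * m * real n)) = rejection_prob A (upd s j 0)" for n
  proof (induction n)
    case (Suc n)
    have "rejection_prob A (upd s j (2 * m * real (Suc n)))
        = rejection_prob A (reflect j m (upd s j (- (2 * m * real n))))"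
      by (simp add: reflect_def algebra_simps)
    then show ?case using Suc by (simp add: inv rejection_prob_upd_uminus[OF A up])
  qed simp
  obtain n where n: "\<bar>s $ j\<bar> / (2 * m) \<le> real n" using real_arch_simple by blast
  have "rejection_prob A (upd s j (s $ j)) \<le> rejection_prob A (upd s j (2 * m * real n))"
    using n m by (intro rejection_prob_upd_mono[OF A up]) (auto simp: field_simps abs_mult)
  moreover have "rejection_prob A (upd s j 0) \<le> rejection_prob A (upd s j (s $ j))"
    by (intro rejection_prob_upd_mono[OF A up]) auto
  ultimately show ?thesis using per[of n] by simp
qed

text \<open>If the power failed to increase, it would not depend on any coordinate in which
  \<open>u\<close> is nonzero. Setting these coordinates to 0 one by one would then give the power
  at 0, contrary to \<open>ne\<close>.\<close>

lemma rejection_prob_ray_strict_mono: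
  fixes u :: "real ^ 'k"
  assumes A: "A \<in> sets borel" and up: "abs_upper A"
    and t: "0 \<le> t" "t < t'" and ne: "rejection_prob A (t *\<^sub>R u) \<noteq> rejection_prob A 0"
  shows "rejection_prob A (t *\<^sub>R u) < rejection_prob A (t' *\<^sub>R u)"
proof (rule ccontr)
  assume "\<not> ?thesis"
  then have ge: "rejection_prob A (t' *\<^sub>R u) \<le> rejection_prob A (t *\<^sub>R u)" by simp
  define v :: "real ^ 'k" where "v = (\<chi> i. \<bar>u $ i\<bar>)"
  have uv: "rejection_prob A (r *\<^sub>R u) = rejection_prob A (r *\<^sub>R v)" for r
    by (intro antisym rejection_prob_abs_mono[OF A up]) (auto simp: v_def abs_mult)
  have eq: "rejection_prob A (t *\<^sub>R v) = rejection_prob A (t' *\<^sub>R v)"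
  proof (rule antisym)
    show "rejection_prob A (t *\<^sub>R v) \<le> rejection_prob A (t' *\<^sub>R v)"
      using t by (intro rejection_prob_abs_mono[OF A up]) (auto simp: abs_mult intro!: mult_right_mono)
  qed (use ge uv in auto)
  have const: "rejection_prob A (upd s j 0) = rejection_prob A s" if j: "v $ j \<noteq> 0" for s j
  proof (rule rejection_prob_upd_const[OF A up])
    have vj: "0 < v $ j" using j by (simp add: v_def)
    \<comment> \<open>The mirror lies halfway between the \<open>j\<close>-th coordinates of the two
      points. Reflecting raises that coordinate alone, so the power at the reflected point is
      squeezed between two equal values.\<close>
    define m where "m = (t + t') * (v $ j) / 2"
    show m: "0 < m" using vj t by (auto simp: m_def)
    have lt: "(t *\<^sub>R v) $ j < m"
      using vj t by (simp add: m_def field_simps)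
    have R: "reflect j m (t *\<^sub>R v) = upd (t *\<^sub>R v) j (t' * v $ j)"
      by (simp add: reflect_def m_def algebra_simps add_divide_distrib)
    have "rejection_prob A (reflect j m (t *\<^sub>R v)) \<le> rejection_prob A (t' *\<^sub>R v)"
      unfolding R using t by (intro rejection_prob_abs_mono[OF A up]) (auto simp: abs_mult intro!: mult_right_mono)
    moreover have "rejection_prob A (t *\<^sub>R v) \<le> rejection_prob A (reflect j m (t *\<^sub>R v))"
      using m lt by (intro rejection_prob_reflect_mono[OF A up]) auto
    ultimately have "rejection_prob A (reflect j m (t *\<^sub>R v)) = rejection_prob A (t *\<^sub>R v)"
      using eq by simp
    then show "rejection_prob A (reflect j m x) = rejection_prob A x" for x
      by (rule rejection_prob_reflect_eqD[OF A up less_imp_le[OF m] less_imp_le[OF lt] lt])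
  qed
  have "rejection_prob A (t *\<^sub>R v) = rejection_prob A (\<chi> i. if i \<in> J then 0 else (t *\<^sub>R v) $ i)" if "finite J" for J
    using that
  proof induction
    case (insert j J)
    let ?w = "\<chi> i. if i \<in> J then 0 else (t *\<^sub>R v) $ i"
    have w: "upd ?w j 0 = (\<chi> i. if i \<in> insert j J then 0 else (t *\<^sub>R v) $ i)"
      by (auto simp: vec_eq_iff)
    show ?case
    proof (cases "v $ j = 0")
      case True
      then have "upd ?w j 0 = ?w" by (auto simp: vec_eq_iff)
      then show ?thesis using insert.IH w by simp
    next
      case False
      then show ?thesis using const[of j ?w] insert.IH w by simp
    qed
  qed (simp add: scaleR_vec_def)
  from this[of UNIV] have "rejection_prob A (t *\<^sub>R v) = rejection_prob A 0"
    by (simp add: zero_vec_def)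
  with ne uv show False by simp
qed

subsection \<open>Quantiles\<close>

text \<open>Lebesgue measure is a positive multiple of its image under a dilation, so dilations
  preserve null sets.\<close>

lemma AE_lborel_scaleR:
  fixes P :: "'a::euclidean_space \<Rightarrow> bool"
  assumes "AE x in lborel. P x" "c \<noteq> 0"
  shows "AE x in lborel. P (c *\<^sub>R x)"
proof -
  have "AE x in density (distr lborel borel (\<lambda>x::'a. 0 + c *\<^sub>R x)) (\<lambda>_. \<bar>c\<bar> ^ DIM('a)). P x"
    using assms by (simp only: lborel_affine[OF assms(2), symmetric])
  then have "AE x in distr lborel borel (\<lambda>x::'a. 0 + c *\<^sub>R x). P x"
    using assms by (subst (asm) AE_density) auto
  from AE_distrD[OF _ this] show ?thesis by simp
qed

text \<open>By \<open>null\<close> the law of \<open>f\<close> has no atoms, so its distribution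
  function is continuous and the intermediate value theorem applies.\<close>

lemma quantile_exists:
  fixes f :: "real ^ 'k \<Rightarrow> real"
  assumes f [measurable]: "f \<in> borel_measurable borel"
    and null: "\<And>c. AE x in lborel. f x \<noteq> c"
    and \<alpha>: "0 < \<alpha>" "\<alpha> < 1"
  obtains c where "measure std_normal_vec {x. f x > c} = \<alpha>"
proof -
  let ?N = "std_normal_vec :: (real ^ 'k) measure"
  have fN: "f \<in> borel_measurable ?N" by measurable
  define D where "D = distr ?N borel f"
  interpret D: real_distribution D
    unfolding D_def using fN by (rule std_normal_vec.real_distribution_distr)
  have atom: "measure D {c} = 0" for c
  proof -
    have "measure D {c} = measure ?N {x. f x = c}"
      unfolding D_def using fN by (subst measure_distr) (auto simp: vimage_def)
    also have "\<dots> = 0"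
      using null[of c] by (subst std_normal_vec.prob_eq_0) (auto simp: AE_std_normal_vec_iff)
    finally show ?thesis .
  qed
  have cont: "continuous_on {a..b} (cdf D)" for a b
    by (intro continuous_at_imp_continuous_on) (simp add: D.isCont_cdf atom)
  have "eventually (\<lambda>c. cdf D c < 1 - \<alpha>) at_bot"
    using \<alpha> by (intro order_tendstoD(2)[OF D.cdf_lim_at_bot]) auto
  then obtain a where a: "cdf D a < 1 - \<alpha>" by (auto simp: eventually_at_bot_linorder)
  have "eventually (\<lambda>c. 1 - \<alpha> < cdf D c) at_top"
    using \<alpha> by (intro order_tendstoD(1)[OF D.cdf_lim_at_top_prob]) auto
  then obtain b where b: "1 - \<alpha> < cdf D b" by (auto simp: eventually_at_top_linorder)
  have "a \<le> b" using D.cdf_nondecreasing[of b a] a b by linarith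
  with IVT'[of "cdf D" a "1 - \<alpha>" b] a b cont obtain c where c: "cdf D c = 1 - \<alpha>"
    by auto
  have "cdf D c = measure ?N {x. f x \<le> c}"
    unfolding D_def cdf_def using fN by (subst measure_distr) (auto simp: vimage_def)
  moreover have "measure ?N {x. f x > c} = 1 - measure ?N {x. f x \<le> c}"
    using std_normal_vec.prob_compl[of "{x. f x \<le> c}"]
    by (simp add: Collect_neg_eq[symmetric] Compl_eq_Diff_UNIV[symmetric] not_le)
  ultimately show ?thesis using c by (intro that[of c]) linarith
qed

section \<open>Positively homogeneous functions under the Gaussian law\<close>

context
  fixes M :: "real ^ 'k \<Rightarrow> real"
  assumes M [measurable]: "M \<in> borel_measurable borel"
    and scale: "\<And>c x. 0 < c \<Longrightarrow> M (c *\<^sub>R x) = c * M x"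
    and pos: "AE x in lborel. 0 < M x"
begin

text \<open>Only countably many level sets can have positive measure, and all level sets at positive
  levels are dilates of each other.\<close>

lemma homogeneous_level_null: "AE x in lborel. M x \<noteq> c"
proof (cases "0 < c")
  case True
  have MN: "M \<in> borel_measurable std_normal_vec" by measurable
  interpret D: prob_space "distr std_normal_vec borel M"
    using MN by (rule std_normal_vec.prob_space_distr)
  have "{0<..<1::real} - {x. measure (distr std_normal_vec borel M) {x} \<noteq> 0} \<noteq> {}"
    using uncountable_open_interval[of "0::real" 1] D.countable_support
    by (metis countable_subset Diff_eq_empty_iff zero_less_one)
  then obtain d where d: "0 < d" "measure (distr std_normal_vec borel M) {d} = 0" by auto
  then have "measure std_normal_vec {x. M x = d} = 0"
    using MN by (subst (asm) measure_distr) (auto simp: vimage_def)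
  then have "AE x in std_normal_vec. M x \<noteq> d"
    by (subst (asm) std_normal_vec.prob_eq_0) auto
  then have "AE x in lborel. M x \<noteq> d" by (simp add: AE_std_normal_vec_iff)
  from AE_lborel_scaleR[OF this, of "d / c"] True d(1) show ?thesis
    by (auto simp: scale field_simps)
next
  case False
  with pos show ?thesis by auto
qed

text \<open>If the shell between the levels \<open>a\<close> and \<open>b\<close> were null, so
  would be its dilates by all integer powers of \<open>b / a\<close>. These countably many shells
  cover every point at which \<open>M\<close> is positive.\<close>

lemma homogeneous_tail_strict:
  assumes "0 < a" "a < b"
  shows "measure std_normal_vec {x. M x > b} < measure std_normal_vec {x. M x > a}"
proof (rule ccontr)
  let ?N = "std_normal_vec :: (real ^ 'k) measure"
  assume "\<not> ?thesis"
  moreover have "measure ?N {x. M x > a} = measure ?N {x. M x > b} + measure ?N {x. a < M x \<and> M x \<le> b}"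
    using assms by (subst std_normal_vec.finite_measure_Union[symmetric])
      (auto intro!: arg_cong[where f = "measure ?N"])
  ultimately have "measure ?N {x. a < M x \<and> M x \<le> b} = 0"
    using measure_nonneg[of ?N "{x. a < M x \<and> M x \<le> b}"] by linarith
  then have "AE x in ?N. \<not> (a < M x \<and> M x \<le> b)"
    by (subst (asm) std_normal_vec.prob_eq_0) auto
  then have null: "AE x in lborel. \<not> (a < M x \<and> M x \<le> b)"
    by (simp add: AE_std_normal_vec_iff)
  define q where "q = b / a"
  have q: "1 < q" "b = a * q" using assms by (auto simp: q_def)
  have "AE x in lborel. \<forall>n::int. \<not> (a < M ((q powr - n) *\<^sub>R x) \<and> M ((q powr - n) *\<^sub>R x) \<le> b)"
    unfolding AE_all_countable using q by (intro allI AE_lborel_scaleR[OF null]) auto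
  with pos have "AE x in (lborel :: (real ^ 'k) measure). False"
  proof eventually_elim
    case (elim x)
    define y where "y = log q (M x / a)"
    \<comment> \<open>This choice gives \<open>n < y \<le> n + 1\<close>, matching the shell, which
      is open below and closed above.\<close>
    define n where "n = \<lceil>y\<rceil> - 1"
    have y: "q powr y = M x / a" using q elim(1) assms by (simp add: y_def)
    have l: "q powr n < q powr y" "q powr y \<le> q powr (n + 1)"
      using q by (auto simp: n_def) linarith+
    define w where "w = q powr - n"
    have w: "0 < w" "w * q powr n = 1" "w * q powr (n + 1) = q"
      using q by (simp_all add: w_def powr_add[symmetric])
    have "1 < w * M x / a" "w * M x / a \<le> q"
      using mult_strict_left_mono[OF l(1) w(1)] mult_left_mono[OF l(2), of w] w
      by (simp_all add: y)
    then have "a < w * M x" "w * M x \<le> b"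
      using q assms by (simp_all add: pos_less_divide_eq pos_divide_le_eq mult.commute)
    then show ?case using elim(2)[rule_format, of n] w(1) by (auto simp: scale w_def)
  qed
  then show False
    unfolding AE_std_normal_vec_iff[symmetric] by (simp add: std_normal_vec.AE_False)
qed

end

section \<open>Critical values of the p-means\<close>

lemma pmean_pos_AE: "AE x in lborel. 0 < pmean p (x :: real ^ 'k)"
proof -
  have "AE x in lborel. \<forall>j. (x :: real ^ 'k) $ j \<noteq> 0"
    unfolding AE_all_countable using AE_lborel_neq_coordinate by blast
  then show ?thesis by eventually_elim (auto intro: pmean_pos)
qed

lemma pmean_tail_strict:
  assumes "0 < a" "a < b"
  shows "measure std_normal_vec {x :: real ^ 'k. pmean p x > b}
    < measure std_normal_vec {x :: real ^ 'k. pmean p x > a}"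
  using borel_measurable_pmean pmean_scaleR pmean_pos_AE assms by (rule homogeneous_tail_strict)

lemma crit_val_tail:
  assumes "0 < \<alpha>" "\<alpha> < 1"
  shows "measure std_normal_vec {z :: real ^ 'k. pmean p z > crit_val TYPE('k) p \<alpha>} = \<alpha>"
proof -
  let ?N = "std_normal_vec :: (real ^ 'k) measure"
  have null: "AE x in lborel. pmean p (x :: real ^ 'k) \<noteq> c" for c
    using borel_measurable_pmean pmean_scaleR pmean_pos_AE by (rule homogeneous_level_null)
  obtain c where c: "measure ?N {x. pmean p x > c} = \<alpha>"
    using quantile_exists[OF borel_measurable_pmean null assms] by blast
  \<comment> \<open>Nonpositive levels have tail probability 1, so the quantile just found is
    positive, as \<open>crit_val\<close> demands.\<close>
  have "measure ?N {x. pmean p x > c} = 1" if "c \<le> 0"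
    using pmean_pos_AE[of p, where 'k = 'k] that
    by (subst std_normal_vec.prob_eq_1) (auto simp: AE_std_normal_vec_iff elim!: eventually_mono)
  with c assms have "0 < c" by fastforce
  with c have "\<exists>!c. c > 0 \<and> measure ?N {x. pmean p x > c} = \<alpha>"
    using pmean_tail_strict[where 'k = 'k, of _ _ p] by (metis less_irrefl linorder_neqE_linordered_idom)
  from theI'[OF this] show "measure ?N {z. pmean p z > crit_val TYPE('k) p \<alpha>} = \<alpha>"
    by (simp add: crit_val_def)
qed

section \<open>Rejection regions and uniqueness of the shift\<close>

definition rejection_region :: "ereal \<Rightarrow> real \<Rightarrow> (real ^ 'k) set" where
  "rejection_region p \<alpha> = {x. pmean p x > crit_val TYPE('k) p \<alpha>}"

lemma rejection_region_borel [measurable]: "rejection_region p \<alpha> \<in> sets borel"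
  unfolding rejection_region_def by measurable

lemma abs_upper_region: "abs_upper (rejection_region p \<alpha>)"
  unfolding abs_upper_def rejection_region_def using pmean_mono by (blast intro: less_le_trans)

lemma is_shift_iff: "is_shift p \<alpha> \<beta> u s \<longleftrightarrow> (\<exists>t>0. s = t *\<^sub>R u) \<and> rejection_prob (rejection_region p \<alpha>) s = \<beta>"
  by (simp add: is_shift_def rejection_prob_def rejection_region_def)

text \<open>Along the ray the power starts at \<open>\<alpha>\<close> and increases strictly beyond
  any point where it differs from \<open>\<alpha>\<close>; hence it takes the value
  \<open>\<beta>\<close> at most once.\<close>

lemma shift_eqI:
  fixes u :: "real ^ 'k"
  assumes "0 < \<alpha>" "\<alpha> < 1" "\<alpha> \<noteq> \<beta>" and s: "is_shift p \<alpha> \<beta> u s"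
  shows "shift p \<alpha> \<beta> u = s"
  unfolding shift_def
proof (rule the_equality[where P = "is_shift p \<alpha> \<beta> u", OF s])
  fix s' assume s': "is_shift p \<alpha> \<beta> u s'"
  have 0: "rejection_prob (rejection_region p \<alpha> :: (real ^ 'k) set) 0 = \<alpha>"
    using crit_val_tail[OF assms(1,2)] by (simp add: rejection_prob_0 rejection_region_def)
  have ray: "\<not> t < t'" if "0 < t" "rejection_prob (rejection_region p \<alpha>) (t *\<^sub>R u) = \<beta>" "rejection_prob (rejection_region p \<alpha>) (t' *\<^sub>R u) = \<beta>" for t t'
  proof
    assume "t < t'"
    moreover have "rejection_prob (rejection_region p \<alpha>) (t *\<^sub>R u) \<noteq> rejection_prob (rejection_region p \<alpha> :: (real ^ 'k) set) 0"
      unfolding 0 that(2) using assms(3) by simp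
    ultimately have "rejection_prob (rejection_region p \<alpha>) (t *\<^sub>R u) < rejection_prob (rejection_region p \<alpha>) (t' *\<^sub>R u)"
      using that(1) by (intro rejection_prob_ray_strict_mono[OF rejection_region_borel abs_upper_region]) simp_all
    then show False by (simp only: that)
  qed
  from s s' obtain t t' where "0 < t" "s = t *\<^sub>R u" "0 < t'" "s' = t' *\<^sub>R u"
    "rejection_prob (rejection_region p \<alpha>) s = \<beta>" "rejection_prob (rejection_region p \<alpha>) s' = \<beta>" by (auto simp: is_shift_iff)
  then show "s' = s" using ray[of t t'] ray[of t' t] by (cases t t' rule: linorder_cases) auto
qed

subsection \<open>Half-spaces\<close>

text \<open>For a unit vector \<open>e\<close> this is the upper tail of the one-dimensional
  standard normal law. It is measured in the full space, so that no marginal law has to be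
  computed.\<close>

definition halfspace_prob :: "real ^ 'k \<Rightarrow> real \<Rightarrow> real" where
  "halfspace_prob e a = measure std_normal_vec {z. z \<bullet> e > a}"

context
  fixes e :: "real ^ 'k"
  assumes e: "norm e = 1"
begin

lemma inner_e_e: "e \<bullet> e = 1"
  using e by (simp add: norm_eq_1)

lemma AE_lborel_neq_inner: "AE x in lborel. x \<bullet> e \<noteq> c"
proof -
  have "negligible {x. e \<bullet> x = c}"
    using e by (intro negligible_hyperplane) auto
  moreover have [measurable]: "{x. x \<bullet> e = c} \<in> sets borel" by measurable
  ultimately have "{x. x \<bullet> e = c} \<in> null_sets lborel"
    by (simp add: negligible_iff_null_sets inner_commute null_sets_completion_iff)
  then show ?thesis by (rule AE_I') auto
qed

lemma halfspace_prob_less: "a < b \<Longrightarrow> halfspace_prob e b < halfspace_prob e a"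
proof -
  assume ab: "a < b"
  let ?U = "{z. a < z \<bullet> e} \<inter> {z. z \<bullet> e < b}"
  have "open ?U"
    by (intro open_Int open_Collect_less continuous_intros)
  moreover have "((a + b) / 2) *\<^sub>R e \<in> ?U"
    using ab by (simp add: inner_e_e)
  ultimately have "0 < measure std_normal_vec ?U"
    by (intro measure_std_normal_vec_open_pos) blast+
  moreover have "halfspace_prob e b + measure std_normal_vec ?U = measure std_normal_vec ({z. z \<bullet> e > b} \<union> ?U)"
    unfolding halfspace_prob_def by (rule std_normal_vec.finite_measure_Union[symmetric]) auto
  moreover have "\<dots> \<le> halfspace_prob e a"
    unfolding halfspace_prob_def using ab by (intro std_normal_vec.finite_measure_mono) auto
  ultimately show ?thesis by linarith
qed

lemma halfspace_prob_less_iff: "halfspace_prob e b < halfspace_prob e a \<longleftrightarrow> a < b"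
  using halfspace_prob_less[of a b] halfspace_prob_less[of b a] by (cases a b rule: linorder_cases) auto

lemma halfspace_prob_le_iff: "halfspace_prob e b \<le> halfspace_prob e a \<longleftrightarrow> a \<le> b"
  using halfspace_prob_less_iff[of a b] by linarith

lemma halfspace_prob_exists:
  assumes "0 < \<alpha>" "\<alpha> < 1"
  obtains a where "halfspace_prob e a = \<alpha>"
proof -
  have "(\<lambda>x. x \<bullet> e) \<in> borel_measurable borel" by measurable
  from quantile_exists[OF this AE_lborel_neq_inner assms] show ?thesis
    using that by (auto simp: halfspace_prob_def)
qed

lemma halfspace_prob_pos: "0 < halfspace_prob e a"
proof -
  have "0 \<le> halfspace_prob e (a + 1)" by (simp add: halfspace_prob_def)
  also have "\<dots> < halfspace_prob e a" by (rule halfspace_prob_less) simp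
  finally show ?thesis .
qed

lemma halfspace_prob_uminus: "halfspace_prob e (- a) = 1 - halfspace_prob e a"
proof -
  have sym: "distr lborel borel uminus = (lborel :: (real ^ 'k) measure)"
    using lborel_affine[of "- 1" "0 :: real ^ 'k"] by (simp add: density_1)
  have "halfspace_prob e (- a) = (\<integral>x. indicator {z. z \<bullet> e > - a} x * gauss x \<partial>distr lborel borel uminus)"
    by (simp add: halfspace_prob_def measure_std_normal_vec sym)
  also have "\<dots> = (\<integral>x. indicator {z. z \<bullet> e < a} x * gauss x \<partial>lborel)"
    by (subst integral_distr)
      (auto simp: gauss_uminus indicator_def intro!: Bochner_Integration.integral_cong)
  also have "\<dots> = measure std_normal_vec {z. z \<bullet> e < a}"
    by (rule measure_std_normal_vec[symmetric]) measurable
  also have "\<dots> = measure std_normal_vec (UNIV - {z. z \<bullet> e > a})"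
  proof (rule std_normal_vec.finite_measure_eq_AE)
    show "AE x in std_normal_vec. x \<in> {z. z \<bullet> e < a} \<longleftrightarrow> x \<in> UNIV - {z. z \<bullet> e > a}"
      unfolding AE_std_normal_vec_iff using AE_lborel_neq_inner[of a] by eventually_elim auto
  qed auto
  also have "\<dots> = 1 - halfspace_prob e a"
    using std_normal_vec.prob_compl[of "{z. z \<bullet> e > a}"] by (simp add: halfspace_prob_def)
  finally show ?thesis .
qed

lemma rejection_prob_halfspace: "rejection_prob {x. x \<bullet> e > a} (t *\<^sub>R e) = halfspace_prob e (a - t)"
  by (simp add: rejection_prob_def halfspace_prob_def inner_add_left inner_e_e algebra_simps)

lemma gauss_shift_e: "gauss (x - t *\<^sub>R e) = exp (t * (x \<bullet> e) - t\<^sup>2 / 2) * gauss x"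
proof -
  have "(norm (x - t *\<^sub>R e))\<^sup>2 = (norm x)\<^sup>2 - 2 * t * (x \<bullet> e) + t\<^sup>2"
    unfolding power2_norm_eq_inner
    by (simp add: inner_diff_left inner_diff_right inner_e_e inner_commute power2_eq_square algebra_simps)
  then show ?thesis
    by (simp add: gauss_eq exp_add[symmetric] diff_divide_distrib add_divide_distrib)
qed

text \<open>By \<open>gauss_shift_e\<close> the likelihood ratio is nondecreasing in
  \<open>x \<bullet> e\<close>, so half-spaces orthogonal to \<open>e\<close> are likelihood ratio
  regions.\<close>

lemma neyman_pearson:
  assumes A [measurable]: "A \<in> sets borel" and size: "measure std_normal_vec A \<le> halfspace_prob e a" and t: "0 \<le> t"
  shows "rejection_prob A (t *\<^sub>R e) \<le> halfspace_prob e (a - t)"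
proof -
  define B where "B = {x. x \<bullet> e > a}"
  \<comment> \<open>The likelihood ratio on the boundary hyperplane of \<open>B\<close>; it acts as
    a multiplier for the size constraint.\<close>
  define \<kappa> where "\<kappa> = exp (t * a - t\<^sup>2 / 2)"
  have B [measurable]: "B \<in> sets borel" unfolding B_def by measurable
  define h where "h C x = indicator C x * gauss (x - t *\<^sub>R e) - \<kappa> * (indicator C x * gauss (x - 0))"
    for C x
  have int: "integrable lborel (h C)" if [measurable]: "C \<in> sets borel" for C
    unfolding h_def[abs_def]
    by (intro Bochner_Integration.integrable_diff integrable_pw integrable_mult_right that)
  have eq: "(\<integral>x. h C x \<partial>lborel) = rejection_prob C (t *\<^sub>R e) - \<kappa> * rejection_prob C 0" if C: "C \<in> sets borel" for C
    unfolding h_def rejection_prob_eq[OF C]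
    by (subst Bochner_Integration.integral_diff) (intro integrable_pw[OF C] integrable_mult_right | simp)+
  \<comment> \<open>On \<open>B\<close> the shifted density is at least \<open>\<kappa>\<close>
    times the unshifted one, off \<open>B\<close> at most that, so \<open>B\<close> is optimal at
    each point.\<close>
  have "h A x \<le> h B x" for x
  proof -
    have "\<kappa> \<le> exp (t * (x \<bullet> e) - t\<^sup>2 / 2)" if "a < x \<bullet> e"
      using that t by (auto simp: \<kappa>_def intro!: mult_left_mono)
    moreover have "exp (t * (x \<bullet> e) - t\<^sup>2 / 2) \<le> \<kappa>" if "x \<bullet> e \<le> a"
      using that t by (auto simp: \<kappa>_def intro!: mult_left_mono)
    ultimately show ?thesis
      using gauss_pos[of x]
      by (auto simp: h_def B_def gauss_shift_e indicator_def not_less mult_right_mono)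
  qed
  then have "(\<integral>x. h A x \<partial>lborel) \<le> (\<integral>x. h B x \<partial>lborel)"
    by (intro integral_mono int A B)
  then have "rejection_prob A (t *\<^sub>R e) - \<kappa> * rejection_prob A 0 \<le> halfspace_prob e (a - t) - \<kappa> * halfspace_prob e a"
    unfolding eq[OF A] eq[OF B] using rejection_prob_halfspace[of a t] rejection_prob_halfspace[of a 0] by (simp add: B_def)
  moreover have "\<kappa> * rejection_prob A 0 \<le> \<kappa> * halfspace_prob e a"
    using size by (simp add: rejection_prob_0 \<kappa>_def)
  ultimately show ?thesis by linarith
qed

subsection \<open>Comparison of the tails of the norm and of a linear form\<close>

text \<open>Outside the ball of radius \<open>r\<close>, the ratio of the standard density to the
  centred Gaussian density with standard deviation \<open>\<sigma>\<close> is at most the right-hand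
  side, and the latter density has total mass 1.\<close>

lemma norm_tail_le:
  assumes \<sigma>: "1 \<le> \<sigma>" and r: "0 \<le> r"
  shows "measure (std_normal_vec :: (real ^ 'k) measure) {z. norm z > r}
    \<le> \<sigma> ^ CARD('k) * exp (- ((1 - 1 / \<sigma>\<^sup>2) * r\<^sup>2) / 2)"
proof -
  define K where "K = \<sigma> ^ CARD('k) * exp (- ((1 - 1 / \<sigma>\<^sup>2) * r\<^sup>2) / 2)"
  define g :: "real ^ 'k \<Rightarrow> real" where "g z = (\<Prod>j\<in>UNIV. normal_density 0 \<sigma> (z $ j))" for z
  have [measurable]: "g \<in> borel_measurable borel" unfolding g_def[abs_def] by measurable
  have K: "0 \<le> K" using \<sigma> by (simp add: K_def)
  have g0: "0 \<le> g z" for z by (simp add: g_def prod_nonneg)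
  have g1: "(\<integral>\<^sup>+z. ennreal (g z) \<partial>lborel) = 1"
    unfolding g_def using \<sigma> by (intro nn_integral_prod_normal_density_vec) auto
  have le: "gauss z \<le> K * g z" if z: "norm z > r" for z
  proof -
    have "r\<^sup>2 \<le> (norm z)\<^sup>2" using z r by (intro power_mono) auto
    then have "(1 - 1 / \<sigma>\<^sup>2) * r\<^sup>2 \<le> (1 - 1 / \<sigma>\<^sup>2) * (norm z)\<^sup>2"
      using \<sigma> by (intro mult_left_mono) auto
    then have "exp (- (norm z)\<^sup>2 / 2)
        \<le> exp (- ((1 - 1 / \<sigma>\<^sup>2) * r\<^sup>2) / 2 + - (norm z)\<^sup>2 / (2 * \<sigma>\<^sup>2))"
      by (simp add: field_simps)
    then have "gauss z \<le> (1 / sqrt (2 * pi)) ^ CARD('k)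
        * (exp (- ((1 - 1 / \<sigma>\<^sup>2) * r\<^sup>2) / 2) * exp (- (norm z)\<^sup>2 / (2 * \<sigma>\<^sup>2)))"
      unfolding gauss_eq exp_add[symmetric] by (intro mult_left_mono) auto
    also have "(1 / sqrt (2 * pi)) ^ CARD('k) = \<sigma> ^ CARD('k) * (1 / sqrt (2 * pi * \<sigma>\<^sup>2)) ^ CARD('k)"
      using \<sigma> by (simp add: real_sqrt_mult power_mult_distrib[symmetric])
    finally show ?thesis
      by (simp add: K_def g_def prod_normal_density_vec mult_ac)
  qed
  have "emeasure (std_normal_vec :: (real ^ 'k) measure) {z. norm z > r}
      = (\<integral>\<^sup>+z. ennreal (gauss (z :: real ^ 'k)) * indicator {z. norm z > r} z \<partial>lborel)"
    unfolding std_normal_vec_eq by (subst emeasure_density) auto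
  also have "\<dots> \<le> (\<integral>\<^sup>+z. ennreal K * ennreal (g z) \<partial>lborel)"
    using le K g0 by (intro nn_integral_mono) (auto simp: indicator_def ennreal_mult[symmetric])
  also have "\<dots> = ennreal K" by (subst nn_integral_cmult) (auto simp: g1)
  finally show ?thesis
    unfolding K_def[symmetric] using K by (simp add: std_normal_vec.emeasure_eq_measure)
qed

text \<open>The unit ball around \<open>(a + 1) *\<^sub>R e\<close> lies in the half-space and
  within distance \<open>a + 2\<close> of the origin, which bounds the density on it from
  below.\<close>

lemma halfspace_prob_lower_bound:
  assumes a: "0 \<le> a"
  shows "(1 / sqrt (2 * pi)) ^ CARD('k) * exp (- (a + 2)\<^sup>2 / 2) * unit_ball_vol CARD('k) \<le> halfspace_prob e a"
proof -
  define K where "K = (1 / sqrt (2 * pi)) ^ CARD('k) * exp (- (a + 2)\<^sup>2 / 2)"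
  let ?B = "ball ((a + 1) *\<^sub>R e) 1"
  have B: "a < z \<bullet> e" "norm z \<le> a + 2" if "z \<in> ?B" for z
  proof -
    from that have d: "norm (z - (a + 1) *\<^sub>R e) < 1" by (simp add: dist_norm norm_minus_commute)
    have "\<bar>(z - (a + 1) *\<^sub>R e) \<bullet> e\<bar> < 1"
      using Cauchy_Schwarz_ineq2[of "z - (a + 1) *\<^sub>R e" e] d e by simp
    then show "a < z \<bullet> e" by (simp add: inner_diff_left inner_e_e)
    show "norm z \<le> a + 2"
      using norm_triangle_sub[of z "(a + 1) *\<^sub>R e"] d e a by simp
  qed
  have "K * unit_ball_vol CARD('k) = K * measure lborel ?B"
    by (simp add: content_ball)
  also have "\<dots> = (\<integral>z. K * indicator ?B z \<partial>lborel)"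
    by simp
  also have "\<dots> \<le> (\<integral>z. indicator ?B z * gauss (z - 0) \<partial>lborel)"
  proof (rule integral_mono)
    show "integrable lborel (\<lambda>z. K * indicator ?B z)"
      by (intro integrable_mult_right integrable_real_indicator) (auto simp: emeasure_ball)
    show "integrable lborel (\<lambda>z. indicator ?B z * gauss (z - 0))"
      by (rule integrable_pw) simp
    show "K * indicator ?B z \<le> indicator ?B z * gauss (z - 0)" for z
    proof (cases "z \<in> ?B")
      case True
      have "(norm z)\<^sup>2 \<le> (a + 2)\<^sup>2" using B(2)[OF True] by (intro power_mono) auto
      then show ?thesis using True
        by (auto simp: K_def gauss_eq intro!: mult_left_mono)
    qed (simp add: indicator_def)
  qed
  also have "\<dots> = rejection_prob ?B 0" by (rule rejection_prob_eq[symmetric]) simp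
  also have "\<dots> \<le> halfspace_prob e a"
    unfolding rejection_prob_0 halfspace_prob_def using B(1) by (intro std_normal_vec.finite_measure_mono) auto
  finally show ?thesis by (simp add: K_def)
qed

text \<open>The dimension enters the two tail bounds only through constants, and enlarging the
  radius by the factor \<open>1 + \<epsilon>\<close> improves the exponent enough to absorb
  them.\<close>

lemma norm_tail_le_halfspace_prob:
  assumes \<epsilon>: "0 < \<epsilon>"
  shows "eventually (\<lambda>a. measure (std_normal_vec :: (real ^ 'k) measure) {z. norm z > (1 + \<epsilon>) * a} \<le> halfspace_prob e a) at_top"
proof -
  \<comment> \<open>With this choice \<open>1 - 1 / \<sigma>\<^sup>2\<close> is
    \<open>1 / (1 + \<epsilon>)\<close>, so at radius \<open>(1 + \<epsilon>) * a\<close> the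
    exponent keeps one factor \<open>1 + \<epsilon>\<close> over the \<open>a\<^sup>2 / 2\<close> of
    the linear form.\<close>
  define \<sigma> where "\<sigma> = sqrt ((1 + \<epsilon>) / \<epsilon>)"
  have s2: "\<sigma>\<^sup>2 = (1 + \<epsilon>) / \<epsilon>" using \<epsilon> by (simp add: \<sigma>_def)
  have s1: "1 \<le> \<sigma>" using \<epsilon> by (simp add: \<sigma>_def)
  define S where "S = \<sigma> ^ CARD('k)"
  have S: "0 < S" using s1 by (simp add: S_def)
  define V where "V = (1 / sqrt (2 * pi)) ^ CARD('k) * unit_ball_vol CARD('k)"
  have V: "0 < V" by (simp add: V_def)
  have "eventually (\<lambda>a. S * exp (- ((1 + \<epsilon>) * a\<^sup>2) / 2) \<le> V * exp (- (a + 2)\<^sup>2 / 2)) at_top"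
  proof -
    have "((\<lambda>a. exp (2 * a + 2 - \<epsilon> * a\<^sup>2 / 2)) \<longlongrightarrow> 0) at_top"
      using \<epsilon> by real_asymp
    then have "eventually (\<lambda>a. exp (2 * a + 2 - \<epsilon> * a\<^sup>2 / 2) < V / S) at_top"
      using V S by (intro order_tendstoD(2)) auto
    then show ?thesis
    proof eventually_elim
      case (elim a)
      have "- ((1 + \<epsilon>) * a\<^sup>2) / 2 = (2 * a + 2 - \<epsilon> * a\<^sup>2 / 2) + - (a + 2)\<^sup>2 / 2"
        by (simp add: field_simps power2_eq_square)
      then have "S * exp (- ((1 + \<epsilon>) * a\<^sup>2) / 2)
          = S * exp (2 * a + 2 - \<epsilon> * a\<^sup>2 / 2) * exp (- (a + 2)\<^sup>2 / 2)"
        by (simp only: exp_add mult.assoc)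
      also have "\<dots> \<le> V * exp (- (a + 2)\<^sup>2 / 2)"
        using elim S by (intro mult_right_mono) (auto simp: field_simps)
      finally show ?case .
    qed
  qed
  with eventually_ge_at_top[of 0] show ?thesis
  proof eventually_elim
    case (elim a)
    have eq: "(1 - 1 / \<sigma>\<^sup>2) * ((1 + \<epsilon>) * a)\<^sup>2 = (1 + \<epsilon>) * a\<^sup>2"
      unfolding s2 using \<epsilon> by (simp add: field_simps power2_eq_square)
    have "measure (std_normal_vec :: (real ^ 'k) measure) {z. norm z > (1 + \<epsilon>) * a}
        \<le> S * exp (- ((1 + \<epsilon>) * a\<^sup>2) / 2)"
      using norm_tail_le[OF s1, of "(1 + \<epsilon>) * a"] \<epsilon> elim(1) unfolding eq S_def by simp
    also note elim(2)
    also have "V * exp (- (a + 2)\<^sup>2 / 2) \<le> halfspace_prob e a"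
      using halfspace_prob_lower_bound[OF elim(1)] by (simp add: V_def mult_ac)
    finally show ?case .
  qed
qed

end

subsection \<open>The shift of the 2-mean test\<close>

text \<open>The indicators converge off a sphere, which is a null set, and dominated convergence
  applies. Continuity is what produces the shift of the 2-mean test.\<close>

lemma continuous_on_pw_norm:
  fixes u :: "real ^ 'k"
  shows "continuous_on T (\<lambda>t. rejection_prob {x. norm x > r} (t *\<^sub>R u))"
proof (intro continuous_at_imp_continuous_on ballI continuous_at_sequentiallyI)
  fix t and X :: "nat \<Rightarrow> real"
  assume X: "X \<longlonglongrightarrow> t"
  let ?f = "\<lambda>t z. indicator {z. norm (z + t *\<^sub>R u) > r} z :: real"
  have eq: "rejection_prob {x. norm x > r} (t *\<^sub>R u) = (\<integral>z. ?f t z \<partial>std_normal_vec)" for t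
    by (simp add: rejection_prob_def)
  have "negligible (sphere (- (t *\<^sub>R u)) r)" by (rule negligible_sphere)
  then have "sphere (- (t *\<^sub>R u)) r \<in> null_sets lborel"
    by (simp add: negligible_iff_null_sets null_sets_completion_iff borel_closed)
  then have "AE z in lborel. norm (z + t *\<^sub>R u) \<noteq> r"
    by (rule AE_I') (auto simp: dist_norm norm_minus_commute[of "- (t *\<^sub>R u)"])
  then have "AE z in std_normal_vec. norm (z + t *\<^sub>R u) \<noteq> r"
    by (simp add: AE_std_normal_vec_iff)
  then have lim: "AE z in std_normal_vec. (\<lambda>n. ?f (X n) z) \<longlonglongrightarrow> ?f t z"
  proof eventually_elim
    case (elim z)
    have N: "(\<lambda>n. norm (z + X n *\<^sub>R u)) \<longlonglongrightarrow> norm (z + t *\<^sub>R u)"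
      by (intro tendsto_intros X)
    have "eventually (\<lambda>n. ?f (X n) z = ?f t z) sequentially"
    proof (cases "r < norm (z + t *\<^sub>R u)")
      case True
      from order_tendstoD(1)[OF N True] show ?thesis
        by eventually_elim (use True in simp)
    next
      case False
      with elim have "norm (z + t *\<^sub>R u) < r" by simp
      from order_tendstoD(2)[OF N this] show ?thesis
        by eventually_elim (use False in simp)
    qed
    then show ?case by (rule tendsto_eventually)
  qed
  show "(\<lambda>n. rejection_prob {x. norm x > r} (X n *\<^sub>R u)) \<longlonglongrightarrow> rejection_prob {x. norm x > r} (t *\<^sub>R u)"
    unfolding eq
    by (rule integral_dominated_convergence[where w = "\<lambda>_. 1", OF _ _ _ lim]) auto
qed

lemma rejection_region_2:
  fixes \<alpha> :: real
  obtains r where "(rejection_region 2 \<alpha> :: (real ^ 'k) set) = {x. norm x > r}"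
proof
  show "(rejection_region 2 \<alpha> :: (real ^ 'k) set)
      = {x. norm x > crit_val TYPE('k) 2 \<alpha> * sqrt (real CARD('k))}"
    unfolding rejection_region_def pmean_2 by (simp add: pos_less_divide_eq)
qed

lemma measure_region:
  assumes "0 < \<alpha>" "\<alpha> < 1"
  shows "measure std_normal_vec (rejection_region p \<alpha> :: (real ^ 'k) set) = \<alpha>"
  using crit_val_tail[OF assms, where 'k = 'k, of p] by (simp add: rejection_region_def)

lemma norm_tail_strict:
  assumes "0 < a" "a < b"
  shows "measure std_normal_vec {x :: real ^ 'k. norm x > b}
    < measure std_normal_vec {x :: real ^ 'k. norm x > a}"
proof -
  have "{x :: real ^ 'k. norm x > c} = {x. pmean 2 x > c / sqrt (real CARD('k))}" for c
    unfolding pmean_2 by (simp add: divide_less_cancel)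
  then show ?thesis
    using assms pmean_tail_strict[where 'k = 'k, of "a / sqrt (real CARD('k))" "b / sqrt (real CARD('k))" 2]
    by (simp add: divide_strict_right_mono)
qed

text \<open>Existence and bound come together: the power is \<open>\<alpha>\<close> at 0 and, by the
  half-space inside the region, at least \<open>\<beta>\<close> at the point of length
  \<open>r + b\<close> on the ray, so it equals \<open>\<beta>\<close> somewhere up to
  there.\<close>

lemma norm_shift_2_le:
  fixes u :: "real ^ 'k"
  assumes u: "u \<noteq> 0" and \<alpha>: "0 < \<alpha>" "\<alpha> < \<beta>" "\<beta> < 1"
    and r: "rejection_region 2 \<alpha> = {x :: real ^ 'k. norm x > r}"
    and b: "halfspace_prob (u /\<^sub>R norm u) b = 1 - \<beta>"
  shows "norm (shift 2 \<alpha> \<beta> u) \<le> r + b"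
proof -
  define e where "e = u /\<^sub>R norm u"
  have e: "norm e = 1" using u by (simp add: e_def)
  have ue: "u = norm u *\<^sub>R e" using u by (simp add: e_def)
  let ?g = "\<lambda>t. rejection_prob (rejection_region 2 \<alpha>) (t *\<^sub>R u)"
  have g0: "?g 0 = \<alpha>" using measure_region[of \<alpha> 2, where 'k = 'k] \<alpha> by (simp add: rejection_prob_0)
  have lower: "halfspace_prob e (r - t * norm u) \<le> ?g t" for t
  proof -
    have "{x. x \<bullet> e > r} \<subseteq> rejection_region 2 \<alpha>"
    proof
      fix x assume "x \<in> {x. x \<bullet> e > r}"
      then show "x \<in> rejection_region 2 \<alpha>"
        using norm_cauchy_schwarz[of x e] unfolding r e by simp
    qed
    then have "rejection_prob {x. x \<bullet> e > r} ((t * norm u) *\<^sub>R e) \<le> rejection_prob (rejection_region 2 \<alpha>) ((t * norm u) *\<^sub>R e)"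
      by (intro rejection_prob_mono) auto
    moreover have "(t * norm u) *\<^sub>R e = t *\<^sub>R u"
      using ue by (metis scaleR_scaleR)
    ultimately show ?thesis using rejection_prob_halfspace[OF e, of r "t * norm u"] by simp
  qed
  have Qb: "halfspace_prob e (- b) = \<beta>" using b halfspace_prob_uminus[OF e, of b] by (simp add: e_def)
  define T where "T = (r + b) / norm u"
  have T: "?g T \<ge> \<beta>"
    using lower[of T] u Qb by (simp add: T_def)
  \<comment> \<open>Comparing the levels \<open>\<alpha> < \<beta>\<close> gives
    \<open>- b \<le> r\<close>, so \<open>T\<close> is nonnegative and the intermediate value
    theorem can be used on \<open>{0..T}\<close>.\<close>
  have "halfspace_prob e r \<le> \<alpha>" using lower[of 0] g0 by simp
  then have "0 \<le> r + b"
    using Qb \<alpha> halfspace_prob_le_iff[OF e, of r "- b"] by linarith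
  then have "0 \<le> T" by (simp add: T_def)
  moreover have "continuous_on {0..T} ?g"
    unfolding r by (rule continuous_on_pw_norm)
  ultimately obtain t where t: "0 \<le> t" "t \<le> T" "?g t = \<beta>"
    using IVT'[of ?g 0 \<beta> T] T g0 \<alpha> by auto
  have "t \<noteq> 0" using t g0 \<alpha> by auto
  with t have "is_shift 2 \<alpha> \<beta> u (t *\<^sub>R u)" by (auto simp: is_shift_iff intro!: exI[of _ t])
  then have "shift 2 \<alpha> \<beta> u = t *\<^sub>R u" using \<alpha> by (intro shift_eqI) auto
  then have "norm (shift 2 \<alpha> \<beta> u) = t * norm u" using t by simp
  also have "\<dots> \<le> T * norm u" using t by (intro mult_right_mono) auto
  also have "\<dots> = r + b" using u by (simp add: T_def)
  finally show ?thesis .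
qed

text \<open>The half-space test of size \<open>\<alpha>\<close> has power
  \<open>halfspace_prob e (a - norm s)\<close> at \<open>s\<close>. By Neyman-Pearson this is at
  least \<open>\<beta>\<close>, which is \<open>halfspace_prob e (- b)\<close>, and tails are
  strictly decreasing.\<close>

lemma norm_shift_ge:
  fixes u :: "real ^ 'k"
  assumes u: "u \<noteq> 0" and \<alpha>: "0 < \<alpha>" "\<alpha> < \<beta>" "\<beta> < 1"
    and a: "halfspace_prob (u /\<^sub>R norm u) a = \<alpha>" and b: "halfspace_prob (u /\<^sub>R norm u) b = 1 - \<beta>"
    and s: "is_shift p \<alpha> \<beta> u s"
  shows "a + b \<le> norm (shift p \<alpha> \<beta> u)"
proof -
  define e where "e = u /\<^sub>R norm u"
  have e: "norm e = 1" using u by (simp add: e_def)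
  from s obtain t where t: "0 < t" "s = t *\<^sub>R u" "rejection_prob (rejection_region p \<alpha>) s = \<beta>"
    by (auto simp: is_shift_iff)
  have se: "s = norm s *\<^sub>R e" using t u by (simp add: e_def)
  have "rejection_prob (rejection_region p \<alpha>) (norm s *\<^sub>R e) \<le> halfspace_prob e (a - norm s)"
    using a \<alpha> measure_region[of \<alpha> p, where 'k = 'k]
    by (intro neyman_pearson[OF e rejection_region_borel]) (auto simp: e_def)
  then have "halfspace_prob e (- b) \<le> halfspace_prob e (a - norm s)"
    using t(3) b halfspace_prob_uminus[OF e, of b] se by (simp add: e_def)
  then have "a + b \<le> norm s" by (simp add: halfspace_prob_le_iff[OF e])
  moreover have "shift p \<alpha> \<beta> u = s" using \<alpha> s by (intro shift_eqI) auto
  ultimately show ?thesis by simp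
qed

section \<open>The efficiency bound and its limit superior\<close>

lemma eventually_ARE2_le:
  fixes u :: "real ^ 'k"
  assumes u: "u \<noteq> 0" and \<epsilon>: "0 < \<epsilon>"
  shows "eventually (\<lambda>(\<alpha>, \<beta>). ARE2 p u \<alpha> \<beta> \<le> (1 + \<epsilon>)\<^sup>2) (at_right 0 \<times>\<^sub>F at_left 1)"
proof -
  define e where "e = u /\<^sub>R norm u"
  have e: "norm e = 1" using u by (simp add: e_def)
  from norm_tail_le_halfspace_prob[OF e \<epsilon>] obtain a0 where a0: "\<And>a. a \<ge> a0 \<Longrightarrow>
      measure (std_normal_vec :: (real ^ 'k) measure) {z. norm z > (1 + \<epsilon>) * a} \<le> halfspace_prob e a"
    by (auto simp: eventually_at_top_linorder)
  have Q0: "halfspace_prob e 0 = 1 / 2" using halfspace_prob_uminus[OF e, of 0] by simp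
  have le: "ARE2 p u \<alpha> \<beta> \<le> (1 + \<epsilon>)\<^sup>2"
    if \<alpha>: "0 < \<alpha>" "\<alpha> < min (halfspace_prob e a0) (1 / 2)" and \<beta>: "1 / 2 < \<beta>" "\<beta> < 1" for \<alpha> \<beta>
  proof (cases "\<exists>s. is_shift p \<alpha> \<beta> u s")
    case True
    then obtain s where s: "is_shift p \<alpha> \<beta> u s" by blast
    obtain a where a: "halfspace_prob e a = \<alpha>" using halfspace_prob_exists[OF e, of \<alpha>] \<alpha> by auto
    obtain b where b: "halfspace_prob e b = 1 - \<beta>" using halfspace_prob_exists[OF e, of "1 - \<beta>"] \<beta> by auto
    \<comment> \<open>A small \<open>\<alpha>\<close> pushes its quantile past the threshold
      \<open>a0\<close> of the tail comparison; levels below 1/2 have positive quantiles.\<close>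
    have a_pos: "a0 < a" "0 < a"
      using \<alpha> a Q0 halfspace_prob_less_iff[OF e, of a a0] halfspace_prob_less_iff[OF e, of a 0] by auto
    have b_pos: "0 < b" using \<beta> b Q0 halfspace_prob_less_iff[OF e, of b 0] by auto
    obtain r where r: "rejection_region 2 \<alpha> = {x :: real ^ 'k. norm x > r}" by (rule rejection_region_2)
    have tail_r: "measure (std_normal_vec :: (real ^ 'k) measure) {x. norm x > r} = \<alpha>"
      using measure_region[of \<alpha> 2, where 'k = 'k] \<alpha> unfolding r by simp
    have "r \<le> (1 + \<epsilon>) * a"
    proof (rule ccontr)
      assume "\<not> ?thesis"
      then have "measure (std_normal_vec :: (real ^ 'k) measure) {x. norm x > r}
          < measure (std_normal_vec :: (real ^ 'k) measure) {x. norm x > (1 + \<epsilon>) * a}"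
        using a_pos \<epsilon> by (intro norm_tail_strict) auto
      also have "\<dots> \<le> \<alpha>" using a0[of a] a_pos a by simp
      finally show False by (simp add: tail_r)
    qed
    have "norm (shift 2 \<alpha> \<beta> u) \<le> r + b"
      using \<alpha> \<beta> b r by (intro norm_shift_2_le[OF u]) (auto simp: e_def)
    \<comment> \<open>Positivity of \<open>b\<close> lets the factor extend to the whole sum, making
      the bound uniform in \<open>\<beta>\<close> and comparable with the lower bound
      \<open>a + b\<close>.\<close>
    also have "\<dots> \<le> (1 + \<epsilon>) * (a + b)"
      using \<open>r \<le> (1 + \<epsilon>) * a\<close> mult_pos_pos[OF \<epsilon> b_pos] by (simp add: algebra_simps)
    also have ab: "a + b \<le> norm (shift p \<alpha> \<beta> u)"
      using \<alpha> \<beta> a b s by (intro norm_shift_ge[OF u]) (auto simp: e_def)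
    then have "(1 + \<epsilon>) * (a + b) \<le> (1 + \<epsilon>) * norm (shift p \<alpha> \<beta> u)"
      using \<epsilon> by (intro mult_left_mono) auto
    finally have "(norm (shift 2 \<alpha> \<beta> u))\<^sup>2 \<le> ((1 + \<epsilon>) * norm (shift p \<alpha> \<beta> u))\<^sup>2"
      by (intro power_mono) auto
    moreover have "0 < norm (shift p \<alpha> \<beta> u)" using ab a_pos b_pos by linarith
    ultimately show ?thesis
      using True by (simp add: ARE2_def power_mult_distrib pos_divide_le_eq)
  next
    case False
    \<comment> \<open>Without a shift the efficiency is 0 by convention.\<close>
    then show ?thesis by (simp add: ARE2_def)
  qed
  have "eventually (\<lambda>\<alpha>. 0 < \<alpha> \<and> \<alpha> < min (halfspace_prob e a0) (1 / 2)) (at_right 0)"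
    using halfspace_prob_pos[OF e, of a0] eventually_at_right_less[of "0 :: real"]
      order_tendstoD(2)[OF tendsto_ident_at, of 0 "min (halfspace_prob e a0) (1 / 2)" "{0<..}"]
    by (intro eventually_conj) auto
  moreover have "eventually (\<lambda>\<beta>. 1 / 2 < \<beta> \<and> \<beta> < (1 :: real)) (at_left 1)"
    using eventually_at_left_real[of "1 / 2 :: real" 1] by simp
  ultimately have "eventually (\<lambda>x. (0 < fst x \<and> fst x < min (halfspace_prob e a0) (1 / 2))
      \<and> 1 / 2 < snd x \<and> snd x < (1 :: real)) (at_right 0 \<times>\<^sub>F at_left 1)"
    by (rule eventually_prodI)
  then show ?thesis
    by (rule eventually_mono) (use le in \<open>simp add: case_prod_beta\<close>)
qed

theorem corollary2p13:
  fixes p :: ereal and u :: "real ^ 'k"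
  assumes "pmean 2 u = 1"
  shows "Limsup (at_right 0 \<times>\<^sub>F at_left 1) (\<lambda>(\<alpha>, \<beta>). ereal (ARE2 p u \<alpha> \<beta>)) \<le> 1"
proof -
  have u: "u \<noteq> 0" using assms unfolding pmean_2 by auto
  let ?L = "Limsup (at_right 0 \<times>\<^sub>F at_left 1) (\<lambda>(\<alpha>, \<beta>). ereal (ARE2 p u \<alpha> \<beta>))"
  \<comment> \<open>The values \<open>1 / real (Suc n)\<close> for \<open>\<epsilon>\<close> are
    positive for every \<open>n\<close> and tend to 0.\<close>
  have le: "?L \<le> ereal ((1 + 1 / real (Suc n))\<^sup>2)" for n
    using eventually_ARE2_le[OF u, of "1 / real (Suc n)" p]
    by (intro Limsup_bounded) (auto elim!: eventually_mono)
  have "(\<lambda>n. ereal ((1 + 1 / real (Suc n))\<^sup>2)) \<longlonglongrightarrow> ereal ((1 + 0)\<^sup>2)"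
    by (intro tendsto_ereal tendsto_intros LIMSEQ_Suc[OF lim_1_over_n])
  then have "?L \<le> ereal ((1 + 0)\<^sup>2)"
    by (rule LIMSEQ_le_const) (use le in blast)
  then show ?thesis by (simp add: one_ereal_def)
qed

end
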